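(* There are infinitely many (pairwise non-isomorphic) connected non-regular undirected graphs $G$ with $\rho(G)=\pi(G)$.
   Context: All graphs are finite, undirected, without loops or parallel edges. For a connected graph $G$ of order $n\ge 2$, $d(u,v)$ is the length of a shortest path between $u$ and $v$; $\sigma(u)=\sum_{v\in V(G)}d(u,v)$; $\bar\sigma(u)=\frac{\sigma(u)}{n-1}$; the proximity is $\pi(G)=\min\{\bar\sigma(u)\mid u\in V(G)\}$ and the remoteness is $\rho(G)=\max\{\bar\sigma(u)\mid u\in V(G)\}$. A graph is regular if all its vertices have the same degree. *)

theory Defs
  imports Complex_Main "Graph_Theory.Graph_Theory"
begin

text \<open>
  A finite simple undirected graph is a loop-free finite symmetric digraph without parallel
  arcs (\<^locale>\<open>graph\<close>, or \<^locale>\<open>pair_graph\<close> when arcs are pairs of vertices): an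
  undirected edge is a pair of opposite arcs. The number of arcs of a path is therefore its
  length, and the out-degree of a vertex is its degree.
\<close>

text \<open>Only meaningful when \<open>v\<close> is reachable from \<open>u\<close>.\<close>

definition path_dist :: "('a,'b) pre_digraph \<Rightarrow> 'a \<Rightarrow> 'a \<Rightarrow> nat" where
  "path_dist G u v = (LEAST k. \<exists>p. pre_digraph.apath G u p v \<and> length p = k)"

definition total_dist :: "('a,'b) pre_digraph \<Rightarrow> 'a \<Rightarrow> nat" where
  "total_dist G u = (\<Sum>v\<in>verts G. path_dist G u v)"

definition avg_dist :: "('a,'b) pre_digraph \<Rightarrow> 'a \<Rightarrow> real" where
  "avg_dist G u = real (total_dist G u) / (real (card (verts G)) - 1)"

definition proximity :: "('a,'b) pre_digraph \<Rightarrow> real" where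
  "proximity G = Min (avg_dist G ` verts G)"

definition remoteness :: "('a,'b) pre_digraph \<Rightarrow> real" where
  "remoteness G = Max (avg_dist G ` verts G)"

definition regular_graph :: "('a,'b) pre_digraph \<Rightarrow> bool" where
  "regular_graph G \<longleftrightarrow> (\<exists>d. \<forall>v\<in>verts G. out_degree G v = d)"

end

theory Submission
  imports Defs
begin

text \<open>
  Blow up a hexagon: with the corners numbered cyclically, put a clique of size \<open>m \<ge> 2\<close> on each
  even corner, a single vertex on each odd corner, and join everything between neighbouring
  corners. A hexagon has diameter 3, with one antipode for each corner. From a vertex at an even
  corner, \<open>(m - 1) + 2\<close> vertices have distance 1, \<open>2 * m\<close> have distance 2 (the other two even
  corners) and one has distance 3. From a vertex at an odd corner, \<open>2 * m\<close> vertices have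
  distance 1, two have distance 2, and the \<open>m\<close> vertices of the antipodal clique have distance 3.
  Both distance sums are \<open>5 * m + 4\<close>: the surplus of near vertices at an odd corner is paid for
  exactly by its large antipode. So all averages agree, whereas the degrees \<open>m + 1\<close> and \<open>2 * m\<close>
  differ. The order \<open>3 * m + 3\<close> tells the graphs of the family apart.

  The distances are certified by \<open>apath_of_potential\<close> and \<open>path_dist_of_potential\<close>: a function
  that vanishes at \<open>v\<close>, drops by at most one along every arc, and drops by one along some arc out
  of each vertex other than \<open>v\<close>, is the distance to \<open>v\<close>.
  Distance sums, degrees and orders are all sums of a quantity depending only on the corner; they
  are evaluated by \<open>sum_hexagon_blowup\<close>.
\<close>

section \<open>Certifying distances by a potential\<close>

text \<open>
  Following the arcs along which the potential drops gives a path; its vertices are distinct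
  since the potential is strictly decreasing, which is why the induction carries a bound on
  the potential of all of them.
\<close>

lemma (in wf_digraph) apath_of_potential:
  fixes f :: "'a \<Rightarrow> nat"
  assumes "u \<in> verts G" and "f v = 0"
    and descent: "\<And>w. w \<in> verts G \<Longrightarrow> w \<noteq> v \<Longrightarrow> \<exists>e\<in>arcs G. tail G e = w \<and> f w = Suc (f (head G e))"
  shows "\<exists>p. apath u p v \<and> length p = f u \<and> (\<forall>x\<in>set (awalk_verts u p). f x \<le> f u)"
  using \<open>u \<in> verts G\<close>
proof (induction "f u" arbitrary: u)
  case 0
  then have "u = v" using descent[of u] by force
  with 0 show ?case by (intro exI[of _ "[]"]) (simp add: apath_Nil_iff)
next
  case (Suc n)
  then have "u \<noteq> v" using \<open>f v = 0\<close> by auto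
  then obtain e where e: "e \<in> arcs G" "tail G e = u" "f u = Suc (f (head G e))"
    using descent Suc.prems by blast
  then obtain p where p: "apath (head G e) p v" "length p = f (head G e)"
      "\<forall>x\<in>set (awalk_verts (head G e) p). f x \<le> f (head G e)"
    using Suc.hyps(1)[of "head G e"] Suc.hyps(2) by auto
  have "u \<notin> set (awalk_verts (head G e) p)"
    using p(3) e(3) by auto
  then have "apath u (e # p) v"
    using e p(1) by (simp add: apath_Cons_iff)
  moreover have "\<forall>x\<in>set (awalk_verts u (e # p)). f x \<le> f u"
    using e p(3) by auto
  ultimately show ?case
    using e(3) p(2) by (intro exI[of _ "e # p"]) simp
qed

lemma (in wf_digraph) potential_le_length_awalk:
  fixes f :: "'a \<Rightarrow> nat"
  assumes "awalk u p v" and "f v = 0"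
    and step: "\<And>e. e \<in> arcs G \<Longrightarrow> f (tail G e) \<le> Suc (f (head G e))"
  shows "f u \<le> length p"
  using assms(1)
proof (induction p arbitrary: u)
  case Nil
  then show ?case using \<open>f v = 0\<close> by (simp add: awalk_Nil_iff)
next
  case (Cons e p)
  then show ?case using step[of e] by (fastforce simp: awalk_Cons_iff)
qed

lemma (in wf_digraph) path_dist_of_potential:
  fixes f :: "'a \<Rightarrow> nat"
  assumes "u \<in> verts G" and "f v = 0"
    and "\<And>e. e \<in> arcs G \<Longrightarrow> f (tail G e) \<le> Suc (f (head G e))"
    and "\<And>w. w \<in> verts G \<Longrightarrow> w \<noteq> v \<Longrightarrow> \<exists>e\<in>arcs G. tail G e = w \<and> f w = Suc (f (head G e))"
  shows "path_dist G u v = f u"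
  unfolding path_dist_def
proof (rule Least_equality)
  show "\<exists>p. apath u p v \<and> length p = f u"
    using apath_of_potential[OF assms(1,2,4)] by blast
next
  fix k assume "\<exists>p. apath u p v \<and> length p = k"
  then show "f u \<le> k"
    using potential_le_length_awalk[OF _ assms(2,3)] awalkI_apath by blast
qed

section \<open>Blowing up alternate corners of a hexagon\<close>

text \<open>
  The distance between the corners \<open>u mod 6\<close> and \<open>v mod 6\<close>: since \<open>5 \<equiv> -1\<close> modulo 6, it is the
  smaller of the residues of \<open>u - v\<close> and \<open>v - u\<close>.
\<close>

definition hex_dist :: "nat \<Rightarrow> nat \<Rightarrow> nat" where
  "hex_dist u v = min ((u + 5 * v) mod 6) ((v + 5 * u) mod 6)"

text \<open>
  The vertex \<open>v\<close> sits at the corner \<open>v mod 6\<close>. The numbers below \<open>6\<close> give one vertex for each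
  corner, and the even numbers below \<open>6 * m\<close> enlarge the even corners to \<open>m\<close> vertices.
\<close>

definition hexagon_blowup :: "nat \<Rightarrow> nat pair_pre_digraph" where
  "hexagon_blowup m =
     (let V = {v. v < 6 \<or> even v \<and> v < 6 * m}
      in \<lparr> pverts = V, parcs = {(u, v). u \<in> V \<and> v \<in> V \<and> u \<noteq> v \<and> hex_dist u v \<le> 1} \<rparr>)"

text \<open>
  Two vertices at the same corner are adjacent, so their distance is 1 rather than that of their
  corners.
\<close>

definition blowup_dist :: "nat \<Rightarrow> nat \<Rightarrow> nat" where
  "blowup_dist u v = (if u = v then 0 else max 1 (hex_dist u v))"

lemma pverts_hexagon_blowup: "pverts (hexagon_blowup m) = {v. v < 6 \<or> even v \<and> v < 6 * m}"
  by (simp add: hexagon_blowup_def Let_def)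

lemma parcs_hexagon_blowup:
  "parcs (hexagon_blowup m) =
     {(u, v). u \<in> pverts (hexagon_blowup m) \<and> v \<in> pverts (hexagon_blowup m) \<and>
              u \<noteq> v \<and> hex_dist u v \<le> 1}"
  by (simp add: hexagon_blowup_def Let_def)

lemma finite_pverts_hexagon_blowup: "finite (pverts (hexagon_blowup m))"
  by (rule finite_subset[of _ "{..<6 + 6 * m}"]) (auto simp: pverts_hexagon_blowup)

lemma hex_dist_commute: "hex_dist u v = hex_dist v u"
  by (simp add: hex_dist_def min.commute)

lemma hex_dist_mod: "hex_dist (u mod 6) (v mod 6) = hex_dist u v"
proof -
  have "(a mod 6 + 5 * (b mod 6)) mod 6 = (a + 5 * b) mod 6" for a b :: nat
    by (intro mod_add_cong mod_mult_cong) simp_all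
  then show ?thesis by (simp only: hex_dist_def)
qed

lemma mod_6_in_corners: "u mod 6 \<in> {0, 1, 2, 3, 4, 5 :: nat}"
proof -
  have "u mod 6 < 6" by simp
  then show ?thesis unfolding insert_iff empty_iff by linarith
qed

lemma hex_dist_triangle: "hex_dist u w \<le> hex_dist u v + hex_dist v w"
proof -
  have "\<forall>a\<in>{0,1,2,3,4,5}. \<forall>b\<in>{0,1,2,3,4,5}. \<forall>c\<in>{0,1,2,3,4,5}.
          hex_dist a c \<le> hex_dist a b + hex_dist b c"
    by code_simp
  then have "hex_dist (u mod 6) (w mod 6) \<le> hex_dist (u mod 6) (v mod 6) + hex_dist (v mod 6) (w mod 6)"
    using mod_6_in_corners by blast
  then show ?thesis by (simp only: hex_dist_mod)
qed

text \<open>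
  The witness is taken below 6 because those numbers are vertices of every blow-up, whatever its
  clique size.
\<close>

lemma hex_dist_descent:
  assumes "2 \<le> hex_dist u v"
  shows "\<exists>w<6. hex_dist u w = 1 \<and> hex_dist u v = Suc (hex_dist w v)"
proof -
  have "\<forall>a\<in>{0,1,2,3,4,5}. \<forall>b\<in>{0,1,2,3,4,5}. 2 \<le> hex_dist a b \<longrightarrow>
          (\<exists>w\<in>{0,1,2,3,4,5}. hex_dist a w = 1 \<and> hex_dist a b = Suc (hex_dist w b))"
    by code_simp
  then have "2 \<le> hex_dist (u mod 6) (v mod 6) \<longrightarrow>
          (\<exists>w\<in>{0,1,2,3,4,5}. hex_dist (u mod 6) w = 1 \<and>
             hex_dist (u mod 6) (v mod 6) = Suc (hex_dist w (v mod 6)))"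
    using mod_6_in_corners by blast
  then obtain w where w: "w \<in> {0,1,2,3,4,5}" "hex_dist (u mod 6) w = 1"
      "hex_dist u v = Suc (hex_dist w (v mod 6))"
    using assms unfolding hex_dist_mod by blast
  from w(1) have "w < 6" by auto
  then have "w mod 6 = w" by simp
  then show ?thesis
    using w \<open>w < 6\<close> hex_dist_mod[of u w] hex_dist_mod[of w v] by (intro exI[of _ w]) simp
qed

lemma pair_graph_hexagon_blowup: "pair_graph (hexagon_blowup m)"
proof
  show "finite (parcs (hexagon_blowup m))"
    by (rule finite_subset[of _ "pverts (hexagon_blowup m) \<times> pverts (hexagon_blowup m)"])
       (auto simp: parcs_hexagon_blowup finite_pverts_hexagon_blowup)
  show "symmetric (with_proj (hexagon_blowup m))"
    by (auto simp: symmetric_def sym_def parcs_hexagon_blowup hex_dist_commute)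
qed (auto simp: parcs_hexagon_blowup finite_pverts_hexagon_blowup)

section \<open>Distances in the blow-up\<close>

lemma blowup_dist_step:
  assumes "e \<in> parcs (hexagon_blowup m)"
  shows "blowup_dist (fst e) v \<le> Suc (blowup_dist (snd e) v)"
proof -
  have "hex_dist (fst e) (snd e) \<le> 1"
    using assms by (auto simp: parcs_hexagon_blowup)
  then show ?thesis
    using hex_dist_triangle[of "fst e" v "snd e"] by (auto simp: blowup_dist_def)
qed

lemma blowup_dist_descent:
  assumes "u \<in> pverts (hexagon_blowup m)" and "v \<in> pverts (hexagon_blowup m)" and "u \<noteq> v"
  shows "\<exists>e\<in>parcs (hexagon_blowup m). fst e = u \<and> blowup_dist u v = Suc (blowup_dist (snd e) v)"
proof (cases "hex_dist u v \<le> 1")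
  case True
  then show ?thesis
    using assms by (intro bexI[of _ "(u, v)"]) (auto simp: parcs_hexagon_blowup blowup_dist_def)
next
  case False
  then obtain w where w: "w < 6" "hex_dist u w = 1" "hex_dist u v = Suc (hex_dist w v)"
    using hex_dist_descent[of u v] by auto
  have "hex_dist x x = 0" for x by (simp add: hex_dist_def)
  then have "w \<noteq> u" "w \<noteq> v" using w False by auto
  then show ?thesis
    using assms w False
    by (intro bexI[of _ "(u, w)"])
       (auto simp: parcs_hexagon_blowup blowup_dist_def pverts_hexagon_blowup)
qed

lemma path_dist_hexagon_blowup:
  assumes "u \<in> pverts (hexagon_blowup m)" and "v \<in> pverts (hexagon_blowup m)"
  shows "path_dist (with_proj (hexagon_blowup m)) u v = blowup_dist u v"
proof -
  interpret pair_graph "hexagon_blowup m" by (rule pair_graph_hexagon_blowup)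
  show ?thesis
    using assms blowup_dist_step blowup_dist_descent
    by (intro path_dist_of_potential) (auto simp: blowup_dist_def)
qed

lemma connected_hexagon_blowup: "Digraph_Component.connected (with_proj (hexagon_blowup m))"
proof -
  interpret pair_graph "hexagon_blowup m" by (rule pair_graph_hexagon_blowup)
  show ?thesis
  proof (rule connectedI)
    show "pverts (hexagon_blowup m) \<noteq> {}"
      by (auto simp: pverts_hexagon_blowup)
  next
    fix u v
    assume "u \<in> pverts (hexagon_blowup m)" "v \<in> pverts (hexagon_blowup m)"
    then have "\<exists>p. apath u p v"
      using apath_of_potential[of u "\<lambda>x. blowup_dist x v" v] blowup_dist_descent[of _ m v]
      by (auto simp: blowup_dist_def)
    then have "u \<rightarrow>\<^sup>*\<^bsub>with_proj (hexagon_blowup m)\<^esub> v"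
      using awalkI_apath reachable_awalk by blast
    then show "u \<rightarrow>\<^sup>*\<^bsub>mk_symmetric (with_proj (hexagon_blowup m))\<^esub> v"
      using reachable_mk_symmetric_eq[OF pair_sym_arcs] by blast
  qed
qed

section \<open>Counting over the corners\<close>

lemma sum_even_corners: "(\<Sum>i<3 * m. h (2 * i mod 6)) = m * (h 0 + h 2 + h (4::nat))"
  for h :: "nat \<Rightarrow> nat"
proof (induction m)
  case (Suc m)
  have "3 * Suc m = Suc (Suc (Suc (3 * m)))" by simp
  moreover have "2 * (3 * m) mod 6 = 0" "2 * Suc (3 * m) mod 6 = 2" "2 * Suc (Suc (3 * m)) mod 6 = 4"
    by presburger+
  ultimately show ?case using Suc by (simp only: sum.lessThan_Suc) (simp add: algebra_simps)
qed simp

lemma sum_hexagon_blowup: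
  fixes h :: "nat \<Rightarrow> nat"
  assumes "1 \<le> m"
  shows "(\<Sum>v\<in>pverts (hexagon_blowup m). h (v mod 6)) = h 1 + h 3 + h 5 + m * (h 0 + h 2 + h 4)"
proof -
  have "pverts (hexagon_blowup m) = {1, 3, 5} \<union> (\<lambda>i. 2 * i) ` {..<3 * m}"
  proof (intro equalityI subsetI)
    fix v assume v: "v \<in> pverts (hexagon_blowup m)"
    show "v \<in> {1, 3, 5} \<union> (\<lambda>i. 2 * i) ` {..<3 * m}"
    proof (cases "even v")
      case True
      then have "v = 2 * (v div 2)" "v div 2 < 3 * m"
        using v \<open>1 \<le> m\<close> by (auto simp: pverts_hexagon_blowup)
      then show ?thesis by blast
    next
      case False
      then have "v < 6" "odd v" using v by (auto simp: pverts_hexagon_blowup)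
      then have "v = 1 \<or> v = 3 \<or> v = 5" by presburger
      then show ?thesis by blast
    qed
  qed (auto simp: pverts_hexagon_blowup)
  moreover have "(\<Sum>v\<in>{1, 3, 5} \<union> (\<lambda>i. 2 * i) ` {..<3 * m}. h (v mod 6)) =
      (\<Sum>v\<in>{1, 3, 5}. h (v mod 6)) + (\<Sum>v\<in>(\<lambda>i. 2 * i) ` {..<3 * m}. h (v mod 6))"
    by (rule sum.union_disjoint) (auto, presburger+)
  moreover have "(\<Sum>v\<in>(\<lambda>i. 2 * i) ` {..<3 * m}. h (v mod 6)) = (\<Sum>i<3 * m. h (2 * i mod 6))"
    by (subst sum.reindex) (auto simp: inj_on_def)
  ultimately show ?thesis by (simp add: sum_even_corners)
qed

lemma card_hexagon_blowup:
  assumes "1 \<le> m"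
  shows "card (pverts (hexagon_blowup m)) = 3 * m + 3"
  using sum_hexagon_blowup[OF assms, of "\<lambda>_. 1"] by simp

text \<open>
  Let every vertex count itself with distance 1, like the other vertices of its corner. Then the
  corners of either parity are at distances 1, 2, 2 or 1, 1, 3, and both triples sum to 5; so the
  weights 1 and \<open>m\<close> of the two parities yield the same total from every corner.
\<close>

lemma total_dist_hexagon_blowup:
  assumes "1 \<le> m" and u: "u \<in> pverts (hexagon_blowup m)"
  shows "total_dist (with_proj (hexagon_blowup m)) u = 5 * m + 4"
proof -
  let ?V = "pverts (hexagon_blowup m)"
  have "total_dist (with_proj (hexagon_blowup m)) u = (\<Sum>v\<in>?V. blowup_dist u v)"
    using u by (simp add: total_dist_def path_dist_hexagon_blowup)
  also have "\<dots> + 1 = (\<Sum>v\<in>?V. max 1 (hex_dist u v))"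
  proof -
    have "(\<Sum>v\<in>?V - {u}. blowup_dist u v) = (\<Sum>v\<in>?V - {u}. max 1 (hex_dist u v))"
      by (rule sum.cong) (auto simp: blowup_dist_def)
    moreover have "blowup_dist u u = 0" "max 1 (hex_dist u u) = 1"
      by (simp_all add: blowup_dist_def hex_dist_def)
    ultimately show ?thesis
      unfolding sum.remove[OF finite_pverts_hexagon_blowup u] by simp
  qed
  also have "\<dots> = (\<Sum>v\<in>?V. max 1 (hex_dist (u mod 6) (v mod 6)))"
    by (simp only: hex_dist_mod)
  also have "\<dots> = 5 * m + 5"
  proof -
    let ?h = "\<lambda>r. max 1 (hex_dist (u mod 6) r)"
    have "\<forall>a\<in>{0,1,2,3,4,5}.
        max 1 (hex_dist a 1) + max 1 (hex_dist a 3) + max 1 (hex_dist a 5) = 5 \<and>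
        max 1 (hex_dist a 0) + max 1 (hex_dist a 2) + max 1 (hex_dist a 4) = 5"
      by code_simp
    then have "?h 1 + ?h 3 + ?h 5 = 5 \<and> ?h 0 + ?h 2 + ?h 4 = 5"
      using mod_6_in_corners by (rule bspec)
    then show ?thesis
      unfolding sum_hexagon_blowup[OF \<open>1 \<le> m\<close>, of ?h] by simp
  qed
  finally show ?thesis by simp
qed

lemma out_degree_hexagon_blowup:
  assumes "1 \<le> m" and u: "u \<in> pverts (hexagon_blowup m)"
  shows "out_degree (with_proj (hexagon_blowup m)) u = (if even u then m + 1 else 2 * m)"
proof -
  let ?V = "pverts (hexagon_blowup m)"
  have "out_arcs (with_proj (hexagon_blowup m)) u = Pair u ` ({v \<in> ?V. hex_dist u v \<le> 1} - {u})"
    using u by (auto simp: out_arcs_def parcs_hexagon_blowup)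
  then have "out_degree (with_proj (hexagon_blowup m)) u = card ({v \<in> ?V. hex_dist u v \<le> 1} - {u})"
    by (simp add: out_degree_def card_image inj_on_def)
  also have "\<dots> + 1 = card {v \<in> ?V. hex_dist u v \<le> 1}"
    using u finite_pverts_hexagon_blowup[of m]
      card.remove[of "{v \<in> ?V. hex_dist u v \<le> 1}" u] by (simp add: hex_dist_def)
  also have "\<dots> = (\<Sum>v\<in>?V. if hex_dist (u mod 6) (v mod 6) \<le> 1 then 1 else 0)"
    by (simp only: hex_dist_mod card_eq_sum sum.inter_filter[OF finite_pverts_hexagon_blowup])
  also have "\<dots> = (if even u then m + 2 else 2 * m + 1)"
  proof -
    let ?h = "\<lambda>r. if hex_dist (u mod 6) r \<le> 1 then 1 else 0 :: nat"
    let ?n = "\<lambda>a r. if hex_dist a r \<le> 1 then 1 else 0 :: nat"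
    have "\<forall>a\<in>{0,1,2,3,4,5}.
        ?n a 1 + ?n a 3 + ?n a 5 = (if even a then 2 else 1) \<and>
        ?n a 0 + ?n a 2 + ?n a 4 = (if even a then 1 else 2)"
      by code_simp
    then have "?h 1 + ?h 3 + ?h 5 = (if even (u mod 6) then 2 else 1) \<and>
          ?h 0 + ?h 2 + ?h 4 = (if even (u mod 6) then 1 else 2)"
      using mod_6_in_corners by (rule bspec)
    moreover have "even (u mod 6) \<longleftrightarrow> even u" by presburger
    ultimately show ?thesis
      unfolding sum_hexagon_blowup[OF \<open>1 \<le> m\<close>, of ?h] by simp
  qed
  finally show ?thesis by (simp split: if_splits)
qed

lemma not_regular_hexagon_blowup:
  assumes "2 \<le> m"
  shows "\<not> regular_graph (with_proj (hexagon_blowup m))"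
proof
  assume "regular_graph (with_proj (hexagon_blowup m))"
  then obtain d where d: "\<forall>v\<in>pverts (hexagon_blowup m). out_degree (with_proj (hexagon_blowup m)) v = d"
    by (auto simp: regular_graph_def)
  have "0 \<in> pverts (hexagon_blowup m)" "1 \<in> pverts (hexagon_blowup m)"
    by (auto simp: pverts_hexagon_blowup)
  then have "m + 1 = d" "2 * m = d"
    using d[rule_format, of 0] d[rule_format, of 1] assms
    by (simp_all add: out_degree_hexagon_blowup)
  then show False using assms by simp
qed

lemma remoteness_eq_proximity_hexagon_blowup:
  assumes "1 \<le> m"
  shows "remoteness (with_proj (hexagon_blowup m)) = proximity (with_proj (hexagon_blowup m))"
proof -
  let ?G = "with_proj (hexagon_blowup m)"
  have "0 \<in> verts ?G" by (simp add: pverts_hexagon_blowup)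
  then have "avg_dist ?G ` verts ?G = {avg_dist ?G 0}"
    using assms by (auto simp: avg_dist_def total_dist_hexagon_blowup)
  then show ?thesis by (simp add: remoteness_def proximity_def)
qed

lemma card_verts_digraph_iso:
  assumes "digraph_iso G H"
  shows "card (verts G) = card (verts H)"
  using assms
  by (auto simp: digraph_iso_def pre_digraph.digraph_isomorphism_inj_on_verts card_image)

theorem theorem4p1:
  shows "\<exists>S :: nat pair_pre_digraph set.
    infinite S \<and>
    pairwise (\<lambda>G H. \<not> digraph_iso (with_proj G) (with_proj H)) S \<and>
    (\<forall>G\<in>S. pair_graph G \<and>
            Digraph_Component.connected (with_proj G) \<and>
            2 \<le> card (pverts G) \<and>
            \<not> regular_graph (with_proj G) \<and>
            remoteness (with_proj G) = proximity (with_proj G))"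
proof (intro exI[of _ "hexagon_blowup ` {2..}"] conjI)
  have same_order: "m = n"
    if "2 \<le> m" "2 \<le> n" "card (pverts (hexagon_blowup m)) = card (pverts (hexagon_blowup n))" for m n
    using that by (simp add: card_hexagon_blowup)
  then have "inj_on hexagon_blowup {2..}"
    by (intro inj_onI) (metis atLeast_iff)
  then show "infinite (hexagon_blowup ` {2..})"
    using infinite_Ici finite_imageD by blast
  show "pairwise (\<lambda>G H. \<not> digraph_iso (with_proj G) (with_proj H)) (hexagon_blowup ` {2..})"
  proof (rule pairwiseI, rule notI)
    fix G H
    assume "G \<in> hexagon_blowup ` {2..}" "H \<in> hexagon_blowup ` {2..}" "G \<noteq> H"
      and iso: "digraph_iso (with_proj G) (with_proj H)"
    then obtain m n where mn: "2 \<le> m" "2 \<le> n" "G = hexagon_blowup m" "H = hexagon_blowup n"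
      by auto
    have "card (pverts G) = card (pverts H)"
      using card_verts_digraph_iso[OF iso] by simp
    then show False
      using same_order[of m n] mn \<open>G \<noteq> H\<close> by blast
  qed
  show "\<forall>G\<in>hexagon_blowup ` {2..}. pair_graph G \<and>
            Digraph_Component.connected (with_proj G) \<and>
            2 \<le> card (pverts G) \<and>
            \<not> regular_graph (with_proj G) \<and>
            remoteness (with_proj G) = proximity (with_proj G)"
    by (simp add: pair_graph_hexagon_blowup connected_hexagon_blowup card_hexagon_blowup
        not_regular_hexagon_blowup remoteness_eq_proximity_hexagon_blowup)
qed

end
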